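(* There exists a constant $c>0$ such that the following holds. Let $X \subseteq \mathbb{R}^d$ be a set of $n$ points, let $k \ge 1$ be an integer and let $0 \le \varepsilon < 1/2$. Let $C$ be the set of $k$ centers output by the $(1+\varepsilon)$-noisy $k$-means++ algorithm (defined in the context) run on $X$ and $k$ against an arbitrary adversary. Then \[ \mathbb{E}[\phi(X,C)] \le c\,(1+\log k)\cdot \mathrm{OPT}_k(X), \] i.e. the $(1+\varepsilon)$-noisy $k$-means++ algorithm is $O(\log k)$-approximate in expectation for the $k$-means problem.
   Context: For a point $x\in\mathbb{R}^d$ and a finite set $C\subseteq \mathbb{R}^d$, $\phi(x,C)=\min_{c\in C}\|x-c\|^2$, and for a finite set $X$, $\phi(X,C)=\sum_{x\in X}\phi(x,C)$. The $k$-means problem asks for a set $C$ of at most $k$ centers minimizing $\phi(X,C)$; $\mathrm{OPT}_k(X)$ denotes the minimum value. The $(1+\varepsilon)$-noisy $k$-means++ algorithm, with input $X$, $k$ and $0\le \varepsilon<1/2$, works as follows. First, a point $x\in X$ is sampled from a distribution in which each point $x$ has probability in $[(1-\varepsilon)\frac1n,(1+\varepsilon)\frac1n]$, and $C_1=\{x\}$. Then, for $i=1,\dots,k-1$, given the current center set $C_i$, a point $x\in X$ is sampled from a distribution in which each point $x$ has probability in $\left[(1-\varepsilon)\frac{\phi(x,C_i)}{\phi(X,C_i)},(1+\varepsilon)\frac{\phi(x,C_i)}{\phi(X,C_i)}\right]$, and $C_{i+1}=C_i\cup\{x\}$. The output is $C=C_k$. In each step the actual sampling distribution is chosen by an adversary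 (possibly depending on everything that happened so far) subject only to these multiplicative constraints. With $\varepsilon=0$ this is the classical $k$-means++ algorithm. *)

theory Defs
  imports "HOL-Probability.Probability_Mass_Function"
begin

(* Points of R^d are represented as functions nat => real whose coordinates
   i >= d vanish; only coordinates i < d enter the distance. *)

definition sqdist_d :: "nat \<Rightarrow> (nat \<Rightarrow> real) \<Rightarrow> (nat \<Rightarrow> real) \<Rightarrow> real" where
  "sqdist_d d x y = (\<Sum>i<d. (x i - y i)^2)"

definition phi_pt :: "nat \<Rightarrow> (nat \<Rightarrow> real) \<Rightarrow> (nat \<Rightarrow> real) set \<Rightarrow> real" where
  "phi_pt d x C = Min ((\<lambda>c. sqdist_d d x c) ` C)"

definition phi :: "nat \<Rightarrow> (nat \<Rightarrow> real) set \<Rightarrow> (nat \<Rightarrow> real) set \<Rightarrow> real" where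
  "phi d X C = (\<Sum>x\<in>X. phi_pt d x C)"

definition OPT :: "nat \<Rightarrow> nat \<Rightarrow> (nat \<Rightarrow> real) set \<Rightarrow> real" where
  "OPT d k X = Inf {phi d X C | C. finite C \<and> C \<noteq> {} \<and> card C \<le> k \<and>
                                   C \<subseteq> {c. \<forall>i\<ge>d. c i = 0}}"

(* An adversary maps the history (list of centers chosen so far, in order)
   to the distribution used for the next sample. *)
type_synonym adversary = "(nat \<Rightarrow> real) list \<Rightarrow> (nat \<Rightarrow> real) pmf"

(* The multiplicative constraints of the (1+eps)-noisy k-means++ algorithm,
   required at every history of fewer than k points of X. If phi(X,C_i) = 0
   (only possible when all points are already centers) the constraint is
   ill-defined; then any distribution on X is allowed. *)
definition valid_adversary ::
  "nat \<Rightarrow> (nat \<Rightarrow> real) set \<Rightarrow> nat \<Rightarrow> real \<Rightarrow> adversary \<Rightarrow> bool" where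
  "valid_adversary d X k \<epsilon> A \<longleftrightarrow>
     (\<forall>h. set h \<subseteq> X \<and> length h < k \<longrightarrow>
        set_pmf (A h) \<subseteq> X \<and>
        (h = [] \<longrightarrow> (\<forall>x\<in>X. (1 - \<epsilon>) / real (card X) \<le> pmf (A h) x \<and>
                                pmf (A h) x \<le> (1 + \<epsilon>) / real (card X))) \<and>
        (h \<noteq> [] \<and> phi d X (set h) \<noteq> 0 \<longrightarrow>
           (\<forall>x\<in>X. (1 - \<epsilon>) * phi_pt d x (set h) / phi d X (set h) \<le> pmf (A h) x \<and>
                   pmf (A h) x \<le> (1 + \<epsilon>) * phi_pt d x (set h) / phi d X (set h))))"

fun noisy_run :: "adversary \<Rightarrow> nat \<Rightarrow> (nat \<Rightarrow> real) list \<Rightarrow> (nat \<Rightarrow> real) list pmf" where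
  "noisy_run A 0 h = return_pmf h"
| "noisy_run A (Suc m) h = bind_pmf (A h) (\<lambda>x. noisy_run A m (h @ [x]))"

definition noisy_kmeanspp :: "adversary \<Rightarrow> nat \<Rightarrow> (nat \<Rightarrow> real) set pmf" where
  "noisy_kmeanspp A k = map_pmf set (noisy_run A k [])"

end

(* The proof is Dasgupta's analysis of k-means++ with one new ingredient. Fix a center set C;
   it splits X into clusters, K of them nonempty. Run K steps; a step is wasted if it hits a
   cluster already covered. After K steps there are as many uncovered clusters as wasted steps,
   so their total cost is (number of wasted steps) * (average uncovered cost). If the average
   never grows in expectation, a step with u uncovered clusters contributes at most
   (covered cost)/(total cost) * (uncovered cost)/u <= (covered cost)/u, and the harmonic sum
   over u >= K, K-1, ... gives the logarithm, the covered cost being O(phi(X,C)) in expectation.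

   With noise the average may grow, since the adversary can prefer cheap clusters, but only by a
   constant factor: let a be the average at some time, call a cluster small if its cost is then
   at most 2a, and let s be the number of small clusters still uncovered. While a cluster costs
   more than 6a, it is hit with probability at least (1/2) 6a/phi, whereas some small cluster is hit
   with probability at most (3/2) 2a s/phi. Hence the sum of the costs above 6a, divided by s + 1,
   is a supermartingale. It starts below 2a because at least half of the clusters are small, and
   6a plus its value bounds the average, so the expected average stays below 8a. *)

theory Submission
  imports Defs
begin

section \<open>Squared distances and the cost function\<close>

lemma sqdist_d_nonneg [simp]: "0 \<le> sqdist_d d x y"
  by (simp add: sqdist_d_def sum_nonneg)

lemma sqdist_d_commute: "sqdist_d d x y = sqdist_d d y x"
  by (simp add: sqdist_d_def power2_commute)

lemma sqdist_d_triangle: "sqdist_d d x z \<le> 2 * sqdist_d d x y + 2 * sqdist_d d y z"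
proof -
  have "(x i - z i)\<^sup>2 \<le> 2 * (x i - y i)\<^sup>2 + 2 * (y i - z i)\<^sup>2" for i
  proof -
    \<comment> \<open>With a = x i - y i and b = y i - z i, this square equals 2 a^2 + 2 b^2 - (a +
      b)^2.\<close>
    have "0 \<le> ((x i - y i) - (y i - z i))\<^sup>2" by simp
    then show ?thesis by (simp add: power2_eq_square algebra_simps)
  qed
  then show ?thesis
    by (simp add: sqdist_d_def sum_distrib_left flip: sum.distrib) (rule sum_mono, simp)
qed

lemma phi_pt_attained:
  assumes "finite S" "S \<noteq> {}"
  obtains c where "c \<in> S" "phi_pt d x S = sqdist_d d x c"
proof -
  have "phi_pt d x S \<in> sqdist_d d x ` S"
    unfolding phi_pt_def using assms by (intro Min_in) auto
  then show ?thesis using that by blast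
qed

lemma phi_pt_le: "finite S \<Longrightarrow> y \<in> S \<Longrightarrow> phi_pt d x S \<le> sqdist_d d x y"
  by (simp add: phi_pt_def)

lemma phi_pt_nonneg: "finite S \<Longrightarrow> S \<noteq> {} \<Longrightarrow> 0 \<le> phi_pt d x S"
  by (metis phi_pt_attained sqdist_d_nonneg)

lemma phi_pt_antimono:
  "finite T \<Longrightarrow> S \<noteq> {} \<Longrightarrow> S \<subseteq> T \<Longrightarrow> phi_pt d x T \<le> phi_pt d x S"
  unfolding phi_pt_def by (rule Min_antimono) auto

lemma phi_pt_triangle:
  assumes "finite S" "S \<noteq> {}"
  shows "phi_pt d y S \<le> 2 * phi_pt d x S + 2 * sqdist_d d x y"
proof -
  obtain c where c: "c \<in> S" "phi_pt d x S = sqdist_d d x c"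
    using phi_pt_attained[OF assms] by blast
  have "phi_pt d y S \<le> sqdist_d d y c" using phi_pt_le assms c by blast
  also have "\<dots> \<le> 2 * sqdist_d d x c + 2 * sqdist_d d x y"
    using sqdist_d_triangle[of d y c x] by (simp add: sqdist_d_commute)
  finally show ?thesis using c by simp
qed

lemma phi_antimono:
  "finite T \<Longrightarrow> S \<noteq> {} \<Longrightarrow> S \<subseteq> T \<Longrightarrow> phi d X T \<le> phi d X S"
  unfolding phi_def by (intro sum_mono phi_pt_antimono)

lemma phi_nonneg: "finite S \<Longrightarrow> S \<noteq> {} \<Longrightarrow> 0 \<le> phi d X S"
  unfolding phi_def by (intro sum_nonneg phi_pt_nonneg)

section \<open>Sampling a center inside one cluster\<close>

lemma sum_sqdist_le:
  assumes "finite P"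
  shows "(\<Sum>y\<in>P. \<Sum>x\<in>P. sqdist_d d x y) \<le> 4 * real (card P) * (\<Sum>x\<in>P. sqdist_d d x c)"
proof -
  have "(\<Sum>y\<in>P. \<Sum>x\<in>P. sqdist_d d x y)
      \<le> (\<Sum>y\<in>P. \<Sum>x\<in>P. 2 * sqdist_d d x c + 2 * sqdist_d d y c)"
  proof (intro sum_mono)
    \<comment> \<open>The detour through the arbitrary point \<open>c\<close> loses a factor 2
      against the centroid identity, but needs no centroids.\<close>
    show "sqdist_d d x y \<le> 2 * sqdist_d d x c + 2 * sqdist_d d y c" for x y
      using sqdist_d_triangle[of d x y c] by (simp add: sqdist_d_commute)
  qed
  also have "\<dots> = 4 * real (card P) * (\<Sum>x\<in>P. sqdist_d d x c)"
    by (simp add: sum.distrib sum_distrib_left[symmetric] algebra_simps)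
  finally show ?thesis .
qed

text \<open>Divided by \<open>phi d P S\<close>, this bounds the expected new cost of
  \<open>P\<close> when a point of \<open>P\<close> is sampled proportionally to its current cost;
  the product form also covers a zero total. Averaging the relaxed triangle inequality over
  \<open>P\<close> shows that \<open>y\<close> has a large weight only if all of \<open>P\<close> is
  expensive or \<open>y\<close> is far from the rest.\<close>

lemma D2_sampling:
  assumes "finite P" "finite S" "S \<noteq> {}"
  shows "(\<Sum>y\<in>P. phi_pt d y S * phi d P (insert y S))
    \<le> 16 * (\<Sum>x\<in>P. sqdist_d d x c) * phi d P S"
proof (cases "P = {}")
  case True
  then show ?thesis by (simp add: phi_def)
next
  case False
  define n where "n = real (card P)"
  define g where "g = (\<lambda>x. phi_pt d x S)"
  define D where "D = (\<lambda>y. \<Sum>x\<in>P. sqdist_d d x y)"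
  define G where "G = phi d P S"
  define o1 where "o1 = (\<Sum>x\<in>P. sqdist_d d x c)"
  have n: "n > 0" using False assms by (simp add: n_def card_gt_0_iff)
  have G: "G = sum g P" by (simp add: G_def g_def phi_def)
  have G0: "0 \<le> G" unfolding G_def by (rule phi_nonneg) (use assms in auto)
  have D0: "0 \<le> D y" for y unfolding D_def by (simp add: sum_nonneg)
  have DD: "sum D P \<le> 4 * n * o1" unfolding D_def n_def o1_def by (rule sum_sqdist_le) fact
  have gD: "n * g y \<le> 2 * G + 2 * D y" for y
  proof -
    have "n * g y = (\<Sum>x\<in>P. g y)" by (simp add: n_def)
    also have "\<dots> \<le> (\<Sum>x\<in>P. 2 * g x + 2 * sqdist_d d x y)"
      unfolding g_def by (intro sum_mono phi_pt_triangle assms)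
    also have "\<dots> = 2 * G + 2 * D y" by (simp add: G D_def sum.distrib sum_distrib_left)
    finally show ?thesis .
  qed
  have new: "phi d P (insert y S) \<le> G" "phi d P (insert y S) \<le> D y"
    "0 \<le> phi d P (insert y S)" for y
    subgoal unfolding G_def by (rule phi_antimono) (use assms in auto)
    subgoal unfolding D_def phi_def by (intro sum_mono phi_pt_le) (use assms in auto)
    subgoal by (rule phi_nonneg) (use assms in auto)
    done
  have "n * (g y * phi d P (insert y S)) \<le> 4 * G * D y" for y
  proof -
    have "n * (g y * phi d P (insert y S)) \<le> (2 * G + 2 * D y) * phi d P (insert y S)"
      using mult_right_mono[OF gD new(3)] by (simp add: mult_ac)
    also have "\<dots> = 2 * G * phi d P (insert y S) + 2 * D y * phi d P (insert y S)"
      by (simp add: algebra_simps)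
    \<comment> \<open>The new cost is at most \<open>G\<close> and at most \<open>D y\<close>; each
      term takes the bound that its own factor lacks.\<close>
    also have "\<dots> \<le> 2 * G * D y + 2 * D y * G"
      using new G0 D0 by (intro add_mono mult_left_mono) auto
    finally show ?thesis by simp
  qed
  then have "n * (\<Sum>y\<in>P. g y * phi d P (insert y S)) \<le> (\<Sum>y\<in>P. 4 * G * D y)"
    by (subst sum_distrib_left) (rule sum_mono)
  also have "\<dots> = 4 * G * sum D P" by (simp add: sum_distrib_left)
  also have "\<dots> \<le> 4 * G * (4 * n * o1)" using DD G0 by (intro mult_left_mono) auto
  also have "\<dots> = n * (16 * o1 * G)" by simp
  finally show ?thesis using n by (simp add: g_def o1_def G_def)
qed

section \<open>The harmonic sum and expectations over a run\<close>

lemma harmonic_sum_le: "m \<ge> 1 \<Longrightarrow> (\<Sum>j=1..m. 1 / real j) \<le> 1 + ln (real m)"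
proof (induction m rule: dec_induct)
  case base
  then show ?case by simp
next
  case (step m)
  have m: "real m > 0" using step by simp
  have "ln (real m / real (Suc m)) \<le> real m / real (Suc m) - 1"
    using m by (intro ln_le_minus_one) simp
  also have "\<dots> = - 1 / real (Suc m)" by (simp add: field_simps)
  finally have "1 / real (Suc m) \<le> ln (real (Suc m)) - ln (real m)"
    using m by (simp add: ln_div)
  then show ?case using step by simp
qed

text \<open>The expectation of \<open>f\<close> after \<open>m\<close> more samples, as a finite sum
  over \<open>X\<close>, so that inductions need no integrability;
  \<open>expectation_noisy_run\<close> links it to the actual process.\<close>

fun adv_expectation ::
  "adversary \<Rightarrow> (nat \<Rightarrow> real) set \<Rightarrow> nat \<Rightarrow> ((nat \<Rightarrow> real) list \<Rightarrow> real) \<Rightarrow> (nat \<Rightarrow> real) list \<Rightarrow> real"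
  where
  "adv_expectation A X 0 f h = f h"
| "adv_expectation A X (Suc m) f h = (\<Sum>x\<in>X. pmf (A h) x * adv_expectation A X m f (h @ [x]))"

lemma adv_expectation_add:
  "adv_expectation A X (m + n) f h = adv_expectation A X m (adv_expectation A X n f) h"
  by (induction m arbitrary: h) auto

lemma adv_expectation_plus:
  "adv_expectation A X m (\<lambda>h. f h + g h) h = adv_expectation A X m f h + adv_expectation A X m g h"
  by (induction m arbitrary: h) (auto simp: algebra_simps sum.distrib)

lemma adv_expectation_cmult:
  "adv_expectation A X m (\<lambda>h. c * f h) h = c * adv_expectation A X m f h"
  by (induction m arbitrary: h) (auto simp: sum_distrib_left mult_ac)

section \<open>Clusters of the reference solution and their hitting probabilities\<close>

locale noisy_instance =
  fixes d :: nat and X :: "(nat \<Rightarrow> real) set" and k :: nat and \<epsilon> :: real and A :: adversary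
    and asg :: "(nat \<Rightarrow> real) \<Rightarrow> (nat \<Rightarrow> real)"
  assumes finX: "finite X" and neX: "X \<noteq> {}" and eps: "0 \<le> \<epsilon>" "\<epsilon> < 1/2"
    and valid: "valid_adversary d X k \<epsilon> A"
begin

abbreviation "E \<equiv> adv_expectation A X"

text \<open>These are exactly the histories at which \<open>valid_adversary\<close> constrains the
  next distribution.\<close>

definition "admissible h \<longleftrightarrow> set h \<subseteq> X \<and> length h < k"

text \<open>
  The list \<open>h\<close> is the sequence of centers sampled so far, while \<open>asg\<close> assigns points to the
  centers of the reference set and clusters are indexed by these reference centers.
  For \<open>h = []\<close> the value of \<open>cost\<close> is junk (\<open>Min {}\<close>), but every cluster is then uncovered and
  \<open>cov_pot\<close> does not look at it. If no cluster is uncovered, \<open>avg\<close> is \<open>0 / 0 = 0\<close>.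
\<close>

definition "cluster c = {x\<in>X. asg x = c}"
definition "cost c h = phi d (cluster c) (set h)"
definition "ideal c = (\<Sum>x\<in>cluster c. sqdist_d d x c)"
definition "hit c h = (\<Sum>x\<in>cluster c. pmf (A h) x)"
definition "uncovered h = asg ` X - asg ` set h"
definition "avg h = (\<Sum>c\<in>uncovered h. cost c h) / real (card (uncovered h))"
definition "wasted h = real (length h) - real (card (asg ` set h))"
definition "cov_pot h = (\<Sum>c\<in>asg`X. if c \<in> uncovered h then 48 * ideal c else cost c h)"

lemma finite_cluster [simp]: "finite (cluster c)" using finX by (simp add: cluster_def)
lemma finite_uncovered [simp]: "finite (uncovered h)" using finX by (simp add: uncovered_def)

lemma sum_pmf: "admissible h \<Longrightarrow> (\<Sum>x\<in>X. pmf (A h) x) = 1"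
  using valid finX by (auto simp: valid_adversary_def admissible_def intro!: sum_pmf_eq_1)

lemma sum_pmf_clusters:
  assumes "J \<subseteq> asg ` X"
  shows "(\<Sum>x\<in>X. pmf (A h) x * (if asg x \<in> J then f (asg x) else 0)) = (\<Sum>c\<in>J. hit c h * f c)"
proof -
  have "(\<Sum>x\<in>X. pmf (A h) x * (if asg x \<in> J then f (asg x) else 0))
      = (\<Sum>c\<in>asg`X. \<Sum>x\<in>cluster c. pmf (A h) x * (if asg x \<in> J then f (asg x) else 0))"
    using finX unfolding cluster_def by (intro sum.image_gen)
  also have "\<dots> = (\<Sum>c\<in>asg`X. if c \<in> J then hit c h * f c else 0)"
    by (intro sum.cong) (auto simp: hit_def cluster_def sum_distrib_right intro!: sum.cong)
  also have "\<dots> = (\<Sum>c\<in>J. hit c h * f c)"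
    using finX assms by (subst sum.inter_restrict[symmetric]) (auto simp: Int_absorb1)
  finally show ?thesis .
qed

lemma phi_eq_sum_cost: "phi d X (set h) = (\<Sum>c\<in>asg`X. cost c h)"
  unfolding phi_def cost_def cluster_def using finX by (intro sum.image_gen)

lemma cost_nonneg: "h \<noteq> [] \<Longrightarrow> 0 \<le> cost c h"
  unfolding cost_def by (rule phi_nonneg) auto

lemma cost_antimono: "h \<noteq> [] \<Longrightarrow> set h \<subseteq> set h' \<Longrightarrow> cost c h' \<le> cost c h"
  unfolding cost_def by (rule phi_antimono) auto

lemma cost_snoc: "h \<noteq> [] \<Longrightarrow> cost c (h @ [x]) \<le> cost c h"
  by (rule cost_antimono) auto

lemma ideal_nonneg: "0 \<le> ideal c"
  by (simp add: ideal_def sum_nonneg)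

lemma hit_nonneg: "0 \<le> hit c h"
  by (simp add: hit_def sum_nonneg)

lemma avg_nonneg: "h \<noteq> [] \<Longrightarrow> 0 \<le> avg h"
  unfolding avg_def by (intro divide_nonneg_nonneg sum_nonneg cost_nonneg) auto

lemma cov_pot_nonneg: "0 \<le> cov_pot h"
proof (cases "h = []")
  case True
  then show ?thesis by (auto simp: cov_pot_def uncovered_def ideal_nonneg intro!: sum_nonneg)
next
  case False
  then show ?thesis by (auto simp: cov_pot_def ideal_nonneg cost_nonneg intro!: sum_nonneg)
qed

text \<open>Settles the degenerate histories of total cost 0, where the adversary may use any
  distribution on \<open>X\<close>.\<close>

lemma cost_zero:
  assumes "h \<noteq> []" "phi d X (set h) = 0" "c \<in> asg ` X"
  shows "cost c h = 0"
proof -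
  have "\<forall>c\<in>asg`X. cost c h = 0"
    using assms(2) finX cost_nonneg[OF assms(1)]
    by (subst (asm) phi_eq_sum_cost, subst (asm) sum_nonneg_eq_0_iff) auto
  then show ?thesis using assms(3) by blast
qed

text \<open>As \<open>\<epsilon>\<close> is below 1/2, the noise factors lie between 1/2 and 3/2;
  everything is doubled to avoid fractions.\<close>

lemma pmf_bounds:
  assumes "admissible h" "h \<noteq> []" "phi d X (set h) \<noteq> 0" "x \<in> X"
  shows "phi_pt d x (set h) / phi d X (set h) \<le> 2 * pmf (A h) x"
    and "2 * pmf (A h) x \<le> 3 * (phi_pt d x (set h) / phi d X (set h))"
proof -
  define r where "r = phi_pt d x (set h) / phi d X (set h)"
  have r: "0 \<le> r" unfolding r_def
    using assms by (intro divide_nonneg_nonneg phi_pt_nonneg phi_nonneg) auto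
  have "(1 - \<epsilon>) * r \<le> pmf (A h) x" "pmf (A h) x \<le> (1 + \<epsilon>) * r"
    using valid assms unfolding valid_adversary_def admissible_def r_def by auto
  moreover have "(1/2) * r \<le> (1 - \<epsilon>) * r" "(1 + \<epsilon>) * r \<le> (3/2) * r"
    using eps r by (intro mult_right_mono; simp)+
  ultimately show "r \<le> 2 * pmf (A h) x" "2 * pmf (A h) x \<le> 3 * r" by auto
qed

lemma hit_bounds:
  assumes "admissible h" "h \<noteq> []" "phi d X (set h) \<noteq> 0"
  shows "cost c h / phi d X (set h) \<le> 2 * hit c h"
    and "2 * hit c h \<le> 3 * (cost c h / phi d X (set h))"
proof -
  have r: "cost c h / phi d X (set h) = (\<Sum>x\<in>cluster c. phi_pt d x (set h) / phi d X (set h))"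
    by (simp add: cost_def phi_def[of d "cluster c"] sum_divide_distrib)
  show "cost c h / phi d X (set h) \<le> 2 * hit c h"
    unfolding r hit_def sum_distrib_left using assms
    by (intro sum_mono pmf_bounds) (auto simp: cluster_def)
  show "2 * hit c h \<le> 3 * (cost c h / phi d X (set h))"
    unfolding r hit_def sum_distrib_left using assms
    by (intro sum_mono pmf_bounds) (auto simp: cluster_def)
qed

text \<open>The invariant \<open>P\<close> excludes histories at which the one-step inequality may
  fail, such as the empty one or those not extending a fixed earlier history.\<close>

lemma E_supermartingale:
  assumes "\<And>h x. admissible h \<Longrightarrow> P h \<Longrightarrow> x \<in> X \<Longrightarrow> P (h @ [x])"
    and "\<And>h. admissible h \<Longrightarrow> P h \<Longrightarrow> (\<Sum>x\<in>X. pmf (A h) x * f (h @ [x])) \<le> f h"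
    and "P h" "set h \<subseteq> X" "length h + m \<le> k"
  shows "E m f h \<le> f h"
  using assms(3-)
proof (induction m arbitrary: h)
  case (Suc m)
  then have adm: "admissible h" by (simp add: admissible_def)
  have "E (Suc m) f h \<le> (\<Sum>x\<in>X. pmf (A h) x * f (h @ [x]))"
    using Suc adm assms(1) by (auto intro!: sum_mono mult_left_mono)
  also have "\<dots> \<le> f h" using assms(2) adm Suc by blast
  finally show ?case .
qed simp

lemma E_mono:
  assumes "\<And>h'. set h' \<subseteq> X \<Longrightarrow> set h \<subseteq> set h' \<Longrightarrow> length h' = length h + m \<Longrightarrow> f h' \<le> g h'"
    and "set h \<subseteq> X"
  shows "E m f h \<le> E m g h"
  using assms
proof (induction m arbitrary: h)
  case (Suc m)
  have "E m f (h @ [x]) \<le> E m g (h @ [x])" if "x \<in> X" for x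
    using Suc.prems that by (intro Suc.IH) auto
  then show ?case by (auto intro!: sum_mono mult_left_mono)
qed simp

lemma E_const: "set h \<subseteq> X \<Longrightarrow> length h + m \<le> k \<Longrightarrow> E m (\<lambda>_. c) h = c"
proof (induction m arbitrary: h)
  case (Suc m)
  then show ?case
    using sum_pmf[of h] by (simp add: admissible_def sum_distrib_right[symmetric])
qed simp

text \<open>Finite support is carried through the induction because expanding the expectation of a
  bind requires it.\<close>

lemma expectation_noisy_run:
  assumes "set h \<subseteq> X" "length h + m \<le> k"
  shows "finite (set_pmf (noisy_run A m h))
    \<and> measure_pmf.expectation (noisy_run A m h) f = E m f h"
  using assms
proof (induction m arbitrary: h)
  case (Suc m)
  then have sub: "set_pmf (A h) \<subseteq> X" using valid by (auto simp: valid_adversary_def)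
  have IH: "finite (set_pmf (noisy_run A m (h @ [x])))"
    "measure_pmf.expectation (noisy_run A m (h @ [x])) f = E m f (h @ [x])" if "x \<in> X" for x
    using Suc that by auto
  have "finite (set_pmf (noisy_run A (Suc m) h))"
    using sub finX IH by (auto simp: finite_subset)
  moreover have "measure_pmf.expectation (noisy_run A (Suc m) h) f = E (Suc m) f h"
    using IH finX sub by (simp add: pmf_expectation_bind[of X])
  ultimately show ?case ..
qed simp

lemma uncovered_snoc: "uncovered (h @ [x]) = uncovered h - {asg x}"
  by (auto simp: uncovered_def)

lemma uncovered_antimono: "set h \<subseteq> set h' \<Longrightarrow> uncovered h' \<subseteq> uncovered h"
  by (auto simp: uncovered_def)

section \<open>Expected growth of the average uncovered cost\<close>

definition "small h0 = {c\<in>uncovered h0. cost c h0 \<le> 2 * avg h0}"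
definition "big h0 h = {c\<in>uncovered h. cost c h > 6 * avg h0}"
text \<open>Thresholds and the set \<open>small h0\<close> are frozen at \<open>h0\<close>, while
  the costs of big clusters are read off at the later history \<open>h\<close>.\<close>

definition "big_pot h0 h =
  (\<Sum>c\<in>big h0 h. cost c h) / real (card (small h0 \<inter> uncovered h) + 1)"

lemma finite_small_big [simp]: "finite (small h0)" "finite (big h0 h)"
  by (simp_all add: small_def big_def)

text \<open>A small cluster starts at most at twice the average at \<open>h0\<close>, and costs
  never rise.\<close>

lemma big_small_disjoint:
  assumes "h0 \<noteq> []" "set h0 \<subseteq> set h"
  shows "big h0 h \<inter> small h0 = {}"
proof -
  have False if "c \<in> big h0 h" "c \<in> small h0" for c
    using that cost_antimono[OF assms, of c] avg_nonneg[OF assms(1)]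
    by (auto simp: big_def small_def)
  then show ?thesis by blast
qed

text \<open>
  The expected gain from shrinking the denominator is at most the expected loss of summands:
  \<open>q / n \<le> hit c h\<close> for every big cluster \<open>c\<close>, where \<open>q\<close> is the probability of hitting one of
  the \<open>n\<close> remaining small clusters.
\<close>

lemma big_pot_step:
  assumes "h0 \<noteq> []" "set h0 \<subseteq> set h" and adm: "admissible h"
  shows "(\<Sum>x\<in>X. pmf (A h) x * big_pot h0 (h @ [x])) \<le> big_pot h0 h"
proof -
  have hne: "h \<noteq> []" using assms by auto
  define B where "B = big h0 h"
  define S where "S = small h0 \<inter> uncovered h"
  define n where "n = real (card S)"
  define q where "q = (\<Sum>c\<in>S. hit c h)"
  have finS: "finite S" "finite B" by (simp_all add: S_def B_def)
  have SX: "S \<subseteq> asg ` X" "B \<subseteq> asg ` X" by (auto simp: S_def B_def big_def uncovered_def)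
  have BS: "B \<inter> S = {}" using big_small_disjoint[OF assms(1,2)] by (auto simp: B_def S_def)
  have a0: "0 \<le> avg h0" using avg_nonneg assms by blast
  have n0: "0 \<le> n" by (simp add: n_def)
  \<comment> \<open>Losing one of n small clusters turns 1/(n+1) into 1/n = (1 + 1/n)/(n+1), and
    hitting \<open>c\<close> deletes its summand. As indicators over the fixed set \<open>B\<close>,
    both effects are linear in the sampling probabilities. For n = 0 the last indicator
    vanishes.\<close>
  have step: "big_pot h0 (h @ [x])
    \<le> (\<Sum>c\<in>B. cost c h * (1 - (if asg x = c then 1 else 0) + (if asg x \<in> S then 1 else 0) / n) / (n + 1))"
    if x: "x \<in> X" for x
  proof -
    define S' where "S' = small h0 \<inter> uncovered (h @ [x])"
    have S': "S' = S - {asg x}" by (auto simp: S'_def S_def uncovered_snoc)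
    have sub: "big h0 (h @ [x]) \<subseteq> B - {asg x}"
      using order_less_le_trans[OF _ cost_snoc[OF hne]]
      by (auto simp: big_def B_def uncovered_snoc)
    have "(\<Sum>c\<in>big h0 (h @ [x]). cost c (h @ [x])) \<le> (\<Sum>c\<in>big h0 (h @ [x]). cost c h)"
      by (intro sum_mono cost_snoc hne)
    also have "\<dots> \<le> (\<Sum>c\<in>B - {asg x}. cost c h)"
      using sub finS cost_nonneg[OF hne] by (intro sum_mono2) auto
    finally have "big_pot h0 (h @ [x]) \<le> (\<Sum>c\<in>B - {asg x}. cost c h) / real (card S' + 1)"
      by (simp add: big_pot_def S'_def divide_right_mono)
    also have "\<dots> = (\<Sum>c\<in>B - {asg x}. cost c h / real (card S' + 1))"
      by (simp add: sum_divide_distrib)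
    also have "\<dots> \<le> (\<Sum>c\<in>B. cost c h * (1 - (if asg x = c then 1 else 0) + (if asg x \<in> S then 1 else 0) / n) / (n + 1))"
    proof (rule sum_le_included[where i = id])
      show "\<forall>c\<in>B - {asg x}. \<exists>b\<in>B. id b = c \<and> cost c h / real (card S' + 1)
        \<le> cost b h * (1 - (if asg x = b then 1 else 0) + (if asg x \<in> S then 1 else 0) / n) / (n + 1)"
      proof
        fix c assume c: "c \<in> B - {asg x}"
        have "cost c h / real (card S' + 1)
          = cost c h * (1 - (if asg x = c then 1 else 0) + (if asg x \<in> S then 1 else 0) / n) / (n + 1)"
        proof (cases "asg x \<in> S")
          case True
          then have "n > 0" using finS by (auto simp: n_def card_gt_0_iff)
          moreover have "card S > 0" using True finS by (auto simp: card_gt_0_iff)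
          then have "real (card S' + 1) = n"
            using True finS by (simp add: S' n_def of_nat_diff)
          moreover have "1 + 1 / n = (n + 1) / n" using \<open>n > 0\<close> by (simp add: field_simps)
          ultimately show ?thesis using c True by auto
        next
          case False
          then show ?thesis using c by (auto simp: S' n_def)
        qed
        then show "\<exists>b\<in>B. id b = c \<and> cost c h / real (card S' + 1)
          \<le> cost b h * (1 - (if asg x = b then 1 else 0) + (if asg x \<in> S then 1 else 0) / n) / (n + 1)"
          using c by auto
      qed
    qed (use finS n0 cost_nonneg[OF hne] in auto)
    finally show ?thesis .
  qed
  have prob: "(\<Sum>x\<in>X. pmf (A h) x * (1 - (if asg x = c then 1 else 0) + (if asg x \<in> S then 1 else 0) / n)) \<le> 1"
    if c: "c \<in> B" for c
  proof -
    have "(\<Sum>x\<in>X. pmf (A h) x * (1 - (if asg x = c then 1 else 0) + (if asg x \<in> S then 1 else 0) / n))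
      = (\<Sum>x\<in>X. pmf (A h) x) - (\<Sum>x\<in>X. pmf (A h) x * (if asg x \<in> {c} then 1 else 0))
        + (\<Sum>x\<in>X. pmf (A h) x * (if asg x \<in> S then 1 else 0)) / n"
      by (simp add: sum.distrib sum_subtractf sum_divide_distrib algebra_simps)
    also have "\<dots> = 1 - hit c h + q / n"
      using SX c by (subst (1 2) sum_pmf_clusters) (auto simp: q_def sum_pmf[OF adm])
    also have "q / n \<le> hit c h"
    proof -
      define F where "F = phi d X (set h)"
      have cB: "cost c h > 6 * avg h0" using c by (simp add: B_def big_def)
      have F0: "0 \<le> F" unfolding F_def by (rule phi_nonneg) (use hne in auto)
      have "F \<noteq> 0" using cost_zero[OF hne, of c] cB a0 c SX by (auto simp: F_def)
      then have F: "F > 0" using F0 by simp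
      have hb: "cost c' h / F \<le> 2 * hit c' h" "2 * hit c' h \<le> 3 * (cost c' h / F)" for c'
        using hit_bounds[OF adm hne] F unfolding F_def by auto
      \<comment> \<open>The thresholds 2 and 6 meet here: the upper noise factor 3 times 2 is what a
        big cluster exceeds with lower noise factor 1.\<close>
      have "2 * hit c' h \<le> 6 * avg h0 / F" if "c' \<in> S" for c'
      proof -
        have "cost c' h \<le> 2 * avg h0"
          using that cost_antimono[OF assms(1,2), of c'] by (auto simp: S_def small_def)
        then have "3 * (cost c' h / F) \<le> 3 * (2 * avg h0 / F)"
          using F by (intro mult_left_mono divide_right_mono) auto
        then show ?thesis using hb(2)[of c'] by simp
      qed
      then have "(\<Sum>c'\<in>S. 2 * hit c' h) \<le> (\<Sum>c'\<in>S. 6 * avg h0 / F)" by (rule sum_mono)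
      then have "2 * q \<le> n * (6 * avg h0 / F)" by (simp add: q_def n_def sum_distrib_left)
      also have "\<dots> \<le> n * (cost c h / F)"
        using cB F n0 by (intro mult_left_mono divide_right_mono) auto
      also have "\<dots> \<le> n * (2 * hit c h)" using hb(1) n0 by (intro mult_left_mono) auto
      finally have "q \<le> n * hit c h" by simp
      then show ?thesis using n0 hit_nonneg[of c h]
        by (cases "n = 0") (auto simp: divide_simps mult_ac)
    qed
    finally show ?thesis by simp
  qed
  have "(\<Sum>x\<in>X. pmf (A h) x * big_pot h0 (h @ [x]))
    \<le> (\<Sum>x\<in>X. pmf (A h) x * (\<Sum>c\<in>B. cost c h * (1 - (if asg x = c then 1 else 0) + (if asg x \<in> S then 1 else 0) / n) / (n + 1)))"
    using step by (intro sum_mono mult_left_mono) auto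
  also have "\<dots> = (\<Sum>c\<in>B. cost c h / (n + 1) * (\<Sum>x\<in>X. pmf (A h) x * (1 - (if asg x = c then 1 else 0) + (if asg x \<in> S then 1 else 0) / n)))"
    unfolding sum_distrib_left by (subst sum.swap) (simp add: mult_ac)
  also have "\<dots> \<le> (\<Sum>c\<in>B. cost c h / (n + 1) * 1)"
    using prob n0 cost_nonneg[OF hne] by (intro sum_mono mult_left_mono) auto
  also have "\<dots> = big_pot h0 h"
    by (simp add: big_pot_def B_def n_def S_def sum_divide_distrib add.commute)
  finally show ?thesis .
qed

lemma avg_le_big_pot:
  assumes "h0 \<noteq> []" "set h0 \<subseteq> set h"
  shows "avg h \<le> 6 * avg h0 + big_pot h0 h"
proof -
  have hne: "h \<noteq> []" using assms by auto
  have a0: "0 \<le> avg h0" using avg_nonneg assms by blast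
  define u where "u = real (card (uncovered h))"
  define b where "b = (\<Sum>c\<in>big h0 h. cost c h)"
  have b0: "0 \<le> b" using cost_nonneg[OF hne] by (simp add: b_def sum_nonneg)
  have bp0: "0 \<le> big_pot h0 h" using b0 by (simp add: big_pot_def b_def)
  show ?thesis
  proof (cases "uncovered h = {}")
    case True
    then show ?thesis using a0 bp0 by (simp add: avg_def)
  next
    case False
    then have u: "u > 0" by (simp add: u_def card_gt_0_iff)
    have "(\<Sum>c\<in>uncovered h. cost c h)
      = (\<Sum>c\<in>uncovered h - big h0 h. cost c h) + b"
      unfolding b_def by (rule sum.subset_diff) (auto simp: big_def)
    also have "(\<Sum>c\<in>uncovered h - big h0 h. cost c h) \<le> (\<Sum>c\<in>uncovered h - big h0 h. 6 * avg h0)"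
      by (intro sum_mono) (auto simp: big_def)
    also have "\<dots> \<le> (\<Sum>c\<in>uncovered h. 6 * avg h0)"
      using a0 by (intro sum_mono2) auto
    finally have "avg h \<le> (u * (6 * avg h0) + b) / u"
      unfolding avg_def u_def by (intro divide_right_mono) auto
    also have "\<dots> = 6 * avg h0 + b / u" using u by (simp add: field_simps)
    also have "b / u \<le> big_pot h0 h"
    proof (cases "big h0 h = {}")
      case True
      then show ?thesis by (simp add: b_def big_pot_def)
    next
      case ne: False
      \<comment> \<open>A big cluster is uncovered but not small, so there is at least one more
        uncovered cluster than small ones left; this pays for the 1 in the denominator of
        \<open>big_pot\<close>.\<close>
      have "small h0 \<inter> uncovered h \<subset> uncovered h"
        using ne big_small_disjoint[OF assms] by (auto simp: big_def)
      then have "card (small h0 \<inter> uncovered h) < card (uncovered h)"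
        by (intro psubset_card_mono) auto
      then have "real (card (small h0 \<inter> uncovered h) + 1) \<le> u" by (simp add: u_def)
      then show ?thesis unfolding big_pot_def b_def[symmetric]
        using b0 u by (intro divide_left_mono) auto
    qed
    finally show ?thesis by simp
  qed
qed

lemma big_pot_initial:
  assumes "h \<noteq> []"
  shows "big_pot h h \<le> 2 * avg h"
proof -
  have a0: "0 \<le> avg h" using avg_nonneg assms by blast
  define U where "U = uncovered h"
  define n where "n = real (card U)"
  define s where "s = real (card (small h))"
  have tot: "(\<Sum>c\<in>U. cost c h) = n * avg h"
    by (cases "U = {}") (auto simp: avg_def n_def U_def)
  have sub: "small h \<subseteq> U" by (auto simp: small_def U_def)
  have finU: "finite U" by (simp add: U_def)
  have bp: "big_pot h h = (\<Sum>c\<in>big h h. cost c h) / (s + 1)"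
    using sub by (simp add: big_pot_def U_def s_def Int_absorb2 add.commute)
  have s0: "0 \<le> s" by (simp add: s_def)
  have le: "(\<Sum>c\<in>big h h. cost c h) \<le> n * avg h"
    unfolding tot[symmetric] using cost_nonneg[OF assms] finU
    by (intro sum_mono2) (auto simp: U_def big_def)
  \<comment> \<open>Markov's inequality: at most half of the uncovered clusters exceed twice the
    average. Keeping the factor \<open>avg h\<close> avoids a case split at average 0.\<close>
  have "(n - s) * (2 * avg h) = (\<Sum>c\<in>U - small h. 2 * avg h)"
    using sub finU by (simp add: n_def s_def card_Diff_subset of_nat_diff card_mono)
  also have "\<dots> \<le> (\<Sum>c\<in>U - small h. cost c h)"
    by (intro sum_mono) (auto simp: small_def U_def)
  also have "\<dots> \<le> (\<Sum>c\<in>U. cost c h)"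
    using cost_nonneg[OF assms] finU by (intro sum_mono2) auto
  finally have "n * avg h \<le> 2 * avg h * s" unfolding tot by (simp add: algebra_simps)
  also have "\<dots> \<le> 2 * avg h * (s + 1)" using a0 by (intro mult_left_mono) auto
  finally show ?thesis using le s0 unfolding bp by (simp add: divide_le_eq)
qed

text \<open>The 6 is the threshold, the 2 the initial potential. The bound is uniform in
  \<open>m\<close>, so a wasted step can be charged with the average at the time it happens.\<close>

lemma E_avg_le:
  assumes "h \<noteq> []" "set h \<subseteq> X" "length h + m \<le> k"
  shows "E m avg h \<le> 8 * avg h"
proof -
  have "E m avg h \<le> E m (\<lambda>h'. 6 * avg h + big_pot h h') h"
    using assms by (intro E_mono avg_le_big_pot)
  also have "\<dots> = 6 * avg h + E m (big_pot h) h"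
    using assms by (simp add: adv_expectation_plus E_const)
  also have "E m (big_pot h) h \<le> big_pot h h"
    using assms by (intro E_supermartingale[where P = "\<lambda>h'. set h \<subseteq> set h'"] big_pot_step) auto
  also have "\<dots> \<le> 2 * avg h" by (rule big_pot_initial) fact
  finally show ?thesis by simp
qed

section \<open>Expected cost of covered clusters\<close>

lemma first_hit_cost:
  assumes "admissible []"
  shows "(\<Sum>y\<in>cluster c. pmf (A []) y * cost c [y]) \<le> 48 * ideal c * hit c []"
proof -
  define N where "N = real (card X)"
  have N: "N > 0" using finX neX by (simp add: N_def card_gt_0_iff)
  have pb: "pmf (A []) y \<le> 3 / (2 * N)" "1 / (2 * N) \<le> pmf (A []) y" if "y \<in> X" for y
  proof -
    have "(1 - \<epsilon>) / N \<le> pmf (A []) y" "pmf (A []) y \<le> (1 + \<epsilon>) / N"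
      using valid[unfolded valid_adversary_def, rule_format, of "[]"] assms that
      by (auto simp: admissible_def N_def)
    moreover have "(1 + \<epsilon>) / N \<le> (3/2) / N" "(1/2) / N \<le> (1 - \<epsilon>) / N"
      using eps N by (intro divide_right_mono; simp)+
    ultimately show "pmf (A []) y \<le> 3 / (2 * N)" "1 / (2 * N) \<le> pmf (A []) y" by auto
  qed
  have cy: "cost c [y] = (\<Sum>x\<in>cluster c. sqdist_d d x y)" for y
    by (simp add: cost_def phi_def phi_pt_def)
  have "(\<Sum>y\<in>cluster c. pmf (A []) y * cost c [y])
    \<le> (\<Sum>y\<in>cluster c. 3 / (2 * N) * cost c [y])"
    using pb cost_nonneg by (intro sum_mono mult_right_mono) (auto simp: cluster_def)
  also have "\<dots> = 3 / (2 * N) * (\<Sum>y\<in>cluster c. \<Sum>x\<in>cluster c. sqdist_d d x y)"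
    by (simp add: cy sum_distrib_left)
  also have "\<dots> \<le> 3 / (2 * N) * (4 * real (card (cluster c)) * ideal c)"
    unfolding ideal_def using N by (intro mult_left_mono sum_sqdist_le) auto
  \<comment> \<open>The cluster size is traded for the hitting probability, as each point has
    probability at least 1/(2N).\<close>
  also have "\<dots> = 12 * ideal c * (\<Sum>y\<in>cluster c. 1 / (2 * N))" by simp
  also have "\<dots> \<le> 12 * ideal c * hit c []"
    unfolding hit_def using ideal_nonneg pb
    by (intro mult_left_mono sum_mono) (auto simp: cluster_def)
  \<comment> \<open>Weakened to the constant of the later steps, so that \<open>cov_pot\<close>
    needs only one.\<close>
  also have "\<dots> \<le> 48 * ideal c * hit c []"
    using ideal_nonneg hit_nonneg by (intro mult_right_mono) auto
  finally show ?thesis .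
qed

text \<open>Given that the cluster is hit, its expected new cost is at most 48 times the ideal one:
  16 from \<open>D2_sampling\<close>, times the ratio 3 of the noise factors. Multiplying by
  \<open>hit c h\<close> avoids conditioning on a null event.\<close>

lemma hit_cost:
  assumes "admissible h" "c \<in> asg ` X"
  shows "(\<Sum>y\<in>cluster c. pmf (A h) y * cost c (h @ [y])) \<le> 48 * ideal c * hit c h"
proof (cases "h = []")
  case True
  then show ?thesis using first_hit_cost assms by simp
next
  case hne: False
  define F where "F = phi d X (set h)"
  show ?thesis
  proof (cases "F = 0")
    case True
    have "cost c (h @ [y]) = 0" for y
      using cost_zero[OF hne, of c] True assms cost_snoc[OF hne, of c y] cost_nonneg[of "h @ [y]" c]
      by (simp add: F_def)
    then show ?thesis using ideal_nonneg hit_nonneg by simp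
  next
    case False
    have F: "F > 0" using False phi_nonneg[of "set h" d X] hne by (simp add: F_def)
    have "2 * (\<Sum>y\<in>cluster c. pmf (A h) y * cost c (h @ [y]))
      = (\<Sum>y\<in>cluster c. 2 * pmf (A h) y * cost c (h @ [y]))"
      by (simp add: sum_distrib_left mult_ac)
    also have "\<dots> \<le> (\<Sum>y\<in>cluster c. 3 * (phi_pt d y (set h) / F) * cost c (h @ [y]))"
      unfolding F_def using False assms hne
      by (intro sum_mono mult_right_mono pmf_bounds(2) cost_nonneg) (auto simp: cluster_def F_def)
    also have "\<dots> = 3 / F * (\<Sum>y\<in>cluster c. phi_pt d y (set h) * phi d (cluster c) (insert y (set h)))"
      by (simp add: sum_distrib_left cost_def mult_ac)
    also have "\<dots> \<le> 3 / F * (16 * ideal c * cost c h)"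
      unfolding ideal_def cost_def using F hne by (intro mult_left_mono D2_sampling) auto
    also have "\<dots> = 48 * ideal c * (cost c h / F)" by simp
    also have "\<dots> \<le> 48 * ideal c * (2 * hit c h)"
      unfolding F_def using False assms hne ideal_nonneg
      by (intro mult_left_mono hit_bounds(1)) (auto simp: F_def)
    finally show ?thesis by simp
  qed
qed

text \<open>Holds for each cluster separately. An uncovered one is booked in advance at the bound of
  \<open>hit_cost\<close> for its expected cost when first hit; a covered one can only become
  cheaper.\<close>

lemma cov_pot_step:
  assumes "admissible h"
  shows "(\<Sum>x\<in>X. pmf (A h) x * cov_pot (h @ [x])) \<le> cov_pot h"
proof -
  define g where "g = (\<lambda>h c. if c \<in> uncovered h then 48 * ideal c else cost c h)"
  have per: "(\<Sum>x\<in>X. pmf (A h) x * g (h @ [x]) c) \<le> g h c" if c: "c \<in> asg ` X" for c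
  proof (cases "c \<in> uncovered h")
    case False
    then have hne: "h \<noteq> []" using c by (auto simp: uncovered_def)
    have "(\<Sum>x\<in>X. pmf (A h) x * g (h @ [x]) c) \<le> (\<Sum>x\<in>X. pmf (A h) x * cost c h)"
      using False cost_snoc[OF hne] by (intro sum_mono mult_left_mono) (auto simp: g_def uncovered_snoc)
    also have "\<dots> = cost c h" by (simp add: sum_pmf[OF assms] flip: sum_distrib_right)
    finally show ?thesis using False by (simp add: g_def)
  next
    case True
    have "(\<Sum>x\<in>X. pmf (A h) x * g (h @ [x]) c)
      = (\<Sum>x\<in>X - cluster c. pmf (A h) x * g (h @ [x]) c) + (\<Sum>x\<in>cluster c. pmf (A h) x * g (h @ [x]) c)"
      using finX by (intro sum.subset_diff) (auto simp: cluster_def)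
    also have "(\<Sum>x\<in>cluster c. pmf (A h) x * g (h @ [x]) c) = (\<Sum>x\<in>cluster c. pmf (A h) x * cost c (h @ [x]))"
      by (intro sum.cong) (auto simp: g_def uncovered_snoc cluster_def)
    also have "\<dots> \<le> 48 * ideal c * hit c h" by (rule hit_cost) fact+
    also have "\<dots> = (\<Sum>x\<in>cluster c. pmf (A h) x * (48 * ideal c))"
      by (simp add: hit_def sum_distrib_left mult_ac)
    also have "(\<Sum>x\<in>X - cluster c. pmf (A h) x * g (h @ [x]) c)
      = (\<Sum>x\<in>X - cluster c. pmf (A h) x * (48 * ideal c))"
      using True by (intro sum.cong) (auto simp: g_def uncovered_snoc cluster_def)
    also have "\<dots> + (\<Sum>x\<in>cluster c. pmf (A h) x * (48 * ideal c)) = (\<Sum>x\<in>X. pmf (A h) x * (48 * ideal c))"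
      using finX by (intro sum.subset_diff[symmetric]) (auto simp: cluster_def)
    also have "\<dots> = 48 * ideal c" by (simp only: sum_pmf[OF assms] mult_1 flip: sum_distrib_right)
    finally show ?thesis using True by (simp add: g_def)
  qed
  have "(\<Sum>x\<in>X. pmf (A h) x * cov_pot (h @ [x])) = (\<Sum>c\<in>asg`X. \<Sum>x\<in>X. pmf (A h) x * g (h @ [x]) c)"
    unfolding cov_pot_def g_def sum_distrib_left by (rule sum.swap)
  also have "\<dots> \<le> (\<Sum>c\<in>asg`X. g h c)" by (intro sum_mono per)
  finally show ?thesis by (simp add: cov_pot_def g_def)
qed

section \<open>Charging the wasted steps\<close>

lemma wasted_snoc: "wasted (h @ [x]) = wasted h + (if asg x \<in> asg ` set h then 1 else 0)"
  by (auto simp: wasted_def insert_absorb)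

lemma card_uncovered:
  assumes "set h \<subseteq> X"
  shows "real (card (uncovered h)) = real (card (asg ` X)) - real (length h) + wasted h"
proof -
  have sub: "asg ` set h \<subseteq> asg ` X" using assms by auto
  have "card (uncovered h) = card (asg ` X) - card (asg ` set h)"
    using finX assms unfolding uncovered_def by (intro card_Diff_subset) auto
  moreover have "card (asg ` set h) \<le> card (asg ` X)" using finX sub by (intro card_mono) auto
  ultimately show ?thesis by (simp add: wasted_def)
qed

lemma wasted_nonneg: "0 \<le> wasted h"
  using card_image_le[of "set h" asg] card_length[of h] by (simp add: wasted_def)

text \<open>A wasted step leaves the uncovered set as it is, so no cheap cluster drops out of the
  average.\<close>

lemma avg_snoc_covered:
  assumes "h \<noteq> []" "asg x \<in> asg ` set h"
  shows "avg (h @ [x]) \<le> avg h"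
proof -
  have "uncovered (h @ [x]) = uncovered h" using assms by (auto simp: uncovered_def)
  then show ?thesis unfolding avg_def
    using cost_snoc[OF assms(1)] by (auto intro!: divide_right_mono sum_mono)
qed

text \<open>A step is wasted with probability at most (3/2) \<open>H / F\<close> and is then charged
  at most 8 \<open>R / u\<close>; since \<open>R\<close> \<le> \<open>F\<close>, at most 12
  \<open>H / u\<close> remains. At least as many clusters are uncovered as steps are left, whence
  the denominator.\<close>

lemma waste_step:
  assumes "admissible h" "h \<noteq> []" "length h + Suc m = card (asg ` X)"
  shows "(\<Sum>x\<in>X. pmf (A h) x * ((wasted (h @ [x]) - wasted h) * (8 * avg (h @ [x]))))
    \<le> 12 * cov_pot h / real (Suc m)"
proof -
  define F where "F = phi d X (set h)"
  define J where "J = asg ` set h"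
  define H where "H = (\<Sum>c\<in>J. cost c h)"
  define R where "R = (\<Sum>c\<in>uncovered h. cost c h)"
  define u where "u = real (card (uncovered h))"
  have JX: "J \<subseteq> asg ` X" using assms by (auto simp: J_def admissible_def)
  have u: "u \<ge> real (Suc m)"
    using card_uncovered[of h] assms wasted_nonneg[of h] by (simp add: u_def admissible_def)
  have H0: "0 \<le> H" and R0: "0 \<le> R"
    using cost_nonneg assms(2) by (auto simp: H_def R_def sum_nonneg)
  have "F = R + H" unfolding F_def phi_eq_sum_cost H_def R_def uncovered_def J_def[symmetric]
    using finX JX by (intro sum.subset_diff) auto
  then have RF: "R \<le> F" using H0 by simp
  have HC: "H \<le> cov_pot h"
  proof -
    have "H = (\<Sum>c\<in>J. if c \<in> uncovered h then 48 * ideal c else cost c h)"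
      unfolding H_def by (intro sum.cong) (auto simp: uncovered_def J_def)
    also have "\<dots> \<le> cov_pot h" unfolding cov_pot_def
      using JX finX ideal_nonneg cost_nonneg assms(2) by (intro sum_mono2) auto
    finally show ?thesis .
  qed
  have "(\<Sum>x\<in>X. pmf (A h) x * ((wasted (h @ [x]) - wasted h) * (8 * avg (h @ [x]))))
    \<le> (\<Sum>x\<in>X. pmf (A h) x * (if asg x \<in> J then 8 * avg h else 0))"
    using avg_snoc_covered[OF assms(2)]
    by (intro sum_mono mult_left_mono) (auto simp: wasted_snoc J_def)
  also have "\<dots> = (\<Sum>c\<in>J. hit c h * (8 * avg h))"
    using sum_pmf_clusters[OF JX, of h "\<lambda>_. 8 * avg h"] by simp
  also have "\<dots> = 4 * avg h * (\<Sum>c\<in>J. 2 * hit c h)" by (simp add: sum_distrib_left mult_ac)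
  also have "\<dots> \<le> 12 * H / u"
  proof (cases "F = 0")
    case True
    then have "R = 0" using RF R0 by simp
    then show ?thesis using H0 by (simp add: avg_def R_def u_def)
  next
    case False
    then have F: "F > 0" using RF R0 by simp
    have "(\<Sum>c\<in>J. 2 * hit c h) \<le> (\<Sum>c\<in>J. 3 * (cost c h / F))"
      using False assms unfolding F_def by (intro sum_mono hit_bounds(2)) auto
    also have "\<dots> = 3 * H / F" by (simp add: H_def sum_distrib_left sum_divide_distrib)
    finally have "4 * avg h * (\<Sum>c\<in>J. 2 * hit c h) \<le> 4 * avg h * (3 * H / F)"
      using avg_nonneg[OF assms(2)] by (intro mult_left_mono) auto
    also have "\<dots> = 12 * H / u * (R / F)" by (simp add: avg_def R_def u_def)
    also have "\<dots> \<le> 12 * H / u * 1"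
      using RF F H0 by (intro mult_left_mono) (auto simp: u_def)
    finally show ?thesis by simp
  qed
  also have "\<dots> \<le> 12 * cov_pot h / real (Suc m)"
    using HC u H0 by (intro frac_le) auto
  finally show ?thesis .
qed

text \<open>Waste is counted from \<open>h\<close> on. After one step it splits into later waste,
  left to the induction, and the waste of this step, whose final average \<open>E_avg_le\<close>
  controls.\<close>

lemma E_waste_le:
  assumes "h \<noteq> []" "set h \<subseteq> X" "length h + m = card (asg ` X)" "card (asg ` X) \<le> k"
  shows "E m (\<lambda>h'. (wasted h' - wasted h) * avg h') h \<le> 12 * cov_pot h * (\<Sum>j=1..m. 1 / real j)"
  using assms
proof (induction m arbitrary: h)
  case (Suc m)
  then have adm: "admissible h" by (simp add: admissible_def)
  define s where "s = (\<Sum>j=1..m. 1 / real j)"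
  have s0: "0 \<le> s" by (simp add: s_def sum_nonneg)
  have step: "E m (\<lambda>h'. (wasted h' - wasted h) * avg h') (h @ [x])
    \<le> 12 * s * cov_pot (h @ [x]) + (wasted (h @ [x]) - wasted h) * (8 * avg (h @ [x]))"
    if x: "x \<in> X" for x
  proof -
    let ?h = "h @ [x]"
    have "E m (\<lambda>h'. (wasted h' - wasted h) * avg h') ?h
      = E m (\<lambda>h'. (wasted h' - wasted ?h) * avg h' + (wasted ?h - wasted h) * avg h') ?h"
      by (simp add: algebra_simps)
    also have "\<dots> = E m (\<lambda>h'. (wasted h' - wasted ?h) * avg h') ?h
        + (wasted ?h - wasted h) * E m avg ?h"
      by (simp only: adv_expectation_plus adv_expectation_cmult)
    also have "\<dots> \<le> 12 * cov_pot ?h * s + (wasted ?h - wasted h) * (8 * avg ?h)"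
      unfolding s_def using Suc x
      by (intro add_mono Suc.IH mult_left_mono E_avg_le) (auto simp: wasted_snoc)
    finally show ?thesis by (simp add: mult_ac)
  qed
  have "E (Suc m) (\<lambda>h'. (wasted h' - wasted h) * avg h') h
    \<le> (\<Sum>x\<in>X. pmf (A h) x * (12 * s * cov_pot (h @ [x]) + (wasted (h @ [x]) - wasted h) * (8 * avg (h @ [x]))))"
    using step by (auto intro!: sum_mono mult_left_mono)
  also have "\<dots> = 12 * s * (\<Sum>x\<in>X. pmf (A h) x * cov_pot (h @ [x]))
     + (\<Sum>x\<in>X. pmf (A h) x * ((wasted (h @ [x]) - wasted h) * (8 * avg (h @ [x]))))"
    by (simp add: distrib_left sum.distrib sum_distrib_left mult_ac)
  also have "\<dots> \<le> 12 * s * cov_pot h + 12 * cov_pot h / real (Suc m)"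
    using s0 Suc.prems adm by (intro add_mono mult_left_mono cov_pot_step waste_step) auto
  also have "\<dots> = 12 * cov_pot h * (\<Sum>j=1..Suc m. 1 / real j)"
    by (simp add: s_def algebra_simps)
  finally show ?case .
qed simp

lemma phi_le_cov_pot_wasted:
  assumes "set h \<subseteq> X" "h \<noteq> []" "length h = card (asg ` X)"
  shows "phi d X (set h) \<le> cov_pot h + wasted h * avg h"
proof -
  have sub: "uncovered h \<subseteq> asg ` X" by (auto simp: uncovered_def)
  have "phi d X (set h) = (\<Sum>c\<in>asg`X - uncovered h. cost c h) + (\<Sum>c\<in>uncovered h. cost c h)"
    unfolding phi_eq_sum_cost using finX sub by (intro sum.subset_diff) auto
  \<comment> \<open>After exactly as many samples as clusters, the number of uncovered clusters is
    \<open>wasted h\<close>.\<close>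
  also have "(\<Sum>c\<in>uncovered h. cost c h) = wasted h * avg h"
    using card_uncovered[of h] assms by (cases "uncovered h = {}") (auto simp: avg_def)
  also have "(\<Sum>c\<in>asg`X - uncovered h. cost c h)
      = (\<Sum>c\<in>asg`X - uncovered h. if c \<in> uncovered h then 48 * ideal c else cost c h)"
    by (intro sum.cong) auto
  also have "\<dots> \<le> cov_pot h" unfolding cov_pot_def
    using finX sub ideal_nonneg cost_nonneg assms by (intro sum_mono2) auto
  finally show ?thesis by simp
qed

section \<open>Assembling the bound\<close>

lemma E_phi_le:
  assumes "card (asg ` X) \<le> k"
  shows "E k (\<lambda>h. phi d X (set h)) [] \<le> 624 * (1 + ln (real k)) * (\<Sum>c\<in>asg`X. ideal c)"
proof -
  define I where "I = (\<Sum>c\<in>asg`X. ideal c)"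
  have I0: "0 \<le> I" by (simp add: I_def sum_nonneg ideal_nonneg)
  have K0: "card (asg ` X) > 0" using finX neX by (simp add: card_gt_0_iff)
  \<comment> \<open>The first sample is split off: it is never wasted, and \<open>E_waste_le\<close>
    starts from a nonempty history.\<close>
  then obtain m where m: "card (asg ` X) = Suc m" using gr0_implies_Suc by blast
  define s where "s = (\<Sum>j=1..m. 1 / real j)"
  have s0: "0 \<le> s" by (simp add: s_def sum_nonneg)
  have k: "Suc m \<le> k" using assms m by simp
  have adm: "admissible []" using k by (simp add: admissible_def)
  have start: "cov_pot [] = 48 * I"
    by (simp add: cov_pot_def uncovered_def I_def sum_distrib_left)
  have s: "s \<le> 1 + ln (real k)"
  proof (cases "m = 0")
    case True
    then show ?thesis using k by (simp add: s_def)
  next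
    case False
    then have "s \<le> 1 + ln (real m)" unfolding s_def by (intro harmonic_sum_le) simp
    also have "\<dots> \<le> 1 + ln (real k)" using False k by simp
    finally show ?thesis .
  qed
  have ph: "phi d X (set (h @ [x])) \<le> phi d X (set h)" if "h \<noteq> []" for h x
    using that by (intro phi_antimono) auto
  have "E k (\<lambda>h. phi d X (set h)) []
    = E (Suc m) (E (k - Suc m) (\<lambda>h. phi d X (set h))) []"
    using k adv_expectation_add[of A X "Suc m" "k - Suc m"] by simp
  \<comment> \<open>Samples beyond the number of clusters can only lower the cost.\<close>
  also have "\<dots> \<le> E (Suc m) (\<lambda>h. phi d X (set h)) []"
  proof (rule E_mono)
    fix h assume h: "set h \<subseteq> X" "length h = length [] + Suc m"
    then have "h \<noteq> []" by auto
    have "(\<Sum>x\<in>X. pmf (A h) x * phi d X (set (h @ [x]))) \<le> phi d X (set h)"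
      if "admissible h" "h \<noteq> []" for h
    proof -
      have "(\<Sum>x\<in>X. pmf (A h) x * phi d X (set (h @ [x]))) \<le> (\<Sum>x\<in>X. pmf (A h) x * phi d X (set h))"
        using ph[OF that(2)] by (intro sum_mono mult_left_mono) auto
      then show ?thesis by (simp add: sum_pmf[OF that(1)] flip: sum_distrib_right)
    qed
    then show "E (k - Suc m) (\<lambda>h. phi d X (set h)) h \<le> phi d X (set h)"
      using h \<open>h \<noteq> []\<close> k by (intro E_supermartingale[where P = "\<lambda>h. h \<noteq> []"]) auto
  qed simp
  also have "\<dots> \<le> E (Suc m) (\<lambda>h. cov_pot h + wasted h * avg h) []"
    using m by (intro E_mono phi_le_cov_pot_wasted) auto
  also have "\<dots> = E (Suc m) cov_pot [] + E (Suc m) (\<lambda>h. wasted h * avg h) []"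
    by (rule adv_expectation_plus)
  also have "E (Suc m) cov_pot [] \<le> cov_pot []"
    using k by (intro E_supermartingale[where P = "\<lambda>_. True"] cov_pot_step) auto
  also have "E (Suc m) (\<lambda>h. wasted h * avg h) [] \<le> 12 * s * cov_pot []"
  proof -
    have "E m (\<lambda>h. wasted h * avg h) [x] \<le> 12 * s * cov_pot [x]" if "x \<in> X" for x
      using E_waste_le[of "[x]" m] that m assms by (simp add: s_def wasted_def mult_ac)
    then have "E (Suc m) (\<lambda>h. wasted h * avg h) [] \<le> (\<Sum>x\<in>X. pmf (A []) x * (12 * s * cov_pot ([] @ [x])))"
      by (auto intro!: sum_mono mult_left_mono)
    also have "\<dots> = 12 * s * (\<Sum>x\<in>X. pmf (A []) x * cov_pot ([] @ [x]))"
      by (simp add: sum_distrib_left mult_ac)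
    also have "\<dots> \<le> 12 * s * cov_pot []"
      using s0 cov_pot_step[OF adm] by (intro mult_left_mono) auto
    finally show ?thesis .
  qed
  also have "cov_pot [] + 12 * s * cov_pot [] = (48 + 576 * s) * I"
    by (simp add: start algebra_simps)
  \<comment> \<open>Here 624 = 48 + 576 and 576 = 12 * 48.\<close>
  also have "\<dots> \<le> (624 * (1 + ln (real k))) * I"
  proof (intro mult_right_mono I0)
    have "0 \<le> ln (real k)" using k by simp
    then show "48 + 576 * s \<le> 624 * (1 + ln (real k))" using s by simp
  qed
  finally show ?thesis by (simp add: I_def)
qed

end

lemma noisy_kmeanspp_le_phi:
  assumes X: "finite X" "X \<noteq> {}" and eps: "0 \<le> \<epsilon>" "\<epsilon> < 1/2"
    and valid: "valid_adversary d X k \<epsilon> A"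
    and C: "finite C" "C \<noteq> {}" "card C \<le> k"
  shows "measure_pmf.expectation (noisy_kmeanspp A k) (phi d X)
    \<le> 624 * (1 + ln (real k)) * phi d X C"
proof -
  have "\<forall>x. \<exists>c. c \<in> C \<and> phi_pt d x C = sqdist_d d x c"
    using phi_pt_attained[OF C(1,2)] by metis
  \<comment> \<open>Only here \<open>asg\<close> becomes a nearest-center map; this choice makes the
    ideal costs add up to \<open>phi d X C\<close>.\<close>
  then obtain asg where asg: "\<And>x. asg x \<in> C" "\<And>x. phi_pt d x C = sqdist_d d x (asg x)"
    by metis
  interpret noisy_instance d X k \<epsilon> A asg by unfold_locales fact+
  have "card (asg ` X) \<le> card C" using asg C by (intro card_mono) auto
  then have le: "card (asg ` X) \<le> k" using C by simp
  have "phi d X C = (\<Sum>c\<in>asg`X. \<Sum>x\<in>cluster c. phi_pt d x C)"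
    unfolding phi_def cluster_def using X by (intro sum.image_gen)
  also have "\<dots> = (\<Sum>c\<in>asg`X. ideal c)"
    unfolding ideal_def by (intro sum.cong) (auto simp: asg cluster_def)
  finally have phiC: "phi d X C = (\<Sum>c\<in>asg`X. ideal c)" .
  have "measure_pmf.expectation (noisy_kmeanspp A k) (phi d X)
    = E k (\<lambda>h. phi d X (set h)) []"
    using expectation_noisy_run[of "[]" k "\<lambda>h. phi d X (set h)"]
    by (simp add: noisy_kmeanspp_def)
  also have "\<dots> \<le> 624 * (1 + ln (real k)) * phi d X C"
    unfolding phiC using le by (rule E_phi_le)
  finally show ?thesis .
qed

theorem theorem1:
  shows "\<exists>c>0. \<forall>(d::nat) (X::(nat \<Rightarrow> real) set) (k::nat) (\<epsilon>::real) (A::adversary).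
     finite X \<and> X \<noteq> {} \<and> X \<subseteq> {x. \<forall>i\<ge>d. x i = 0} \<and> k \<ge> 1 \<and>
     0 \<le> \<epsilon> \<and> \<epsilon> < 1/2 \<and> valid_adversary d X k \<epsilon> A \<longrightarrow>
     measure_pmf.expectation (noisy_kmeanspp A k) (\<lambda>C. phi d X C)
       \<le> c * (1 + ln (real k)) * OPT d k X"
proof (intro exI[of _ 624] conjI allI impI)
  fix d :: nat and X :: "(nat \<Rightarrow> real) set" and k :: nat and \<epsilon> :: real and A :: adversary
  assume asm: "finite X \<and> X \<noteq> {} \<and> X \<subseteq> {x. \<forall>i\<ge>d. x i = 0} \<and> k \<ge> 1 \<and>
     0 \<le> \<epsilon> \<and> \<epsilon> < 1/2 \<and> valid_adversary d X k \<epsilon> A"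
  define b where "b = 624 * (1 + ln (real k))"
  define e where "e = measure_pmf.expectation (noisy_kmeanspp A k) (\<lambda>C. phi d X C)"
  have "0 \<le> ln (real k)" using asm by simp
  then have b: "b > 0" by (simp add: b_def)
  \<comment> \<open>\<open>OPT\<close> is an infimum, so the bound is shown against every competing
    \<open>C\<close>; dividing by the positive \<open>b\<close> turns it into a lower bound of the
    set.\<close>
  have "e / b \<le> OPT d k X"
    unfolding OPT_def
  proof (rule cInf_greatest)
    \<comment> \<open>The origin alone is a feasible center set, so the infimum is over a nonempty
      set.\<close>
    have "finite {\<lambda>_. 0 :: real} \<and> {\<lambda>_. 0 :: real} \<noteq> {} \<and> card {\<lambda>_. 0 :: real} \<le> k
      \<and> {\<lambda>_. 0 :: real} \<subseteq> {c. \<forall>i\<ge>d. c i = 0}"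
      using asm by simp
    then show "{phi d X C | C. finite C \<and> C \<noteq> {} \<and> card C \<le> k \<and> C \<subseteq> {c. \<forall>i\<ge>d. c i = 0}} \<noteq> {}"
      by blast
  next
    fix y assume "y \<in> {phi d X C | C. finite C \<and> C \<noteq> {} \<and> card C \<le> k \<and> C \<subseteq> {c. \<forall>i\<ge>d. c i = 0}}"
    then obtain C where C: "y = phi d X C" "finite C" "C \<noteq> {}" "card C \<le> k" by blast
    have "e \<le> b * phi d X C"
      unfolding e_def b_def using asm C by (intro noisy_kmeanspp_le_phi) auto
    then show "e / b \<le> y" using b C by (simp add: divide_le_eq mult.commute)
  qed
  then show "e \<le> 624 * (1 + ln (real k)) * OPT d k X"
    unfolding b_def[symmetric] using b by (simp add: divide_le_eq mult.commute)
qed simp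

end
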